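(* Consider the 3-component Camassa–Holm type system for $u_1,u_2,u_3$: $$\begin{aligned}&m_{1t}+u_2gm_{1x}-m_3(u_{2x}f-u_2g)-m_1(3u_2f-m_3u_2)=0,\\&m_{2t}+u_2gm_{2x}+m_2(3u_{2x}g+m_3u_2)=0,\\&m_{3t}+u_2gm_{3x}-m_3(2u_2f+u_{2x}g-m_3u_2)=0,\\&m_i=u_i-u_{ixx}\ (i=1,2,3),\quad f=u_3-u_{1x},\quad g=u_1-u_{3x}.\end{aligned}$$ Then it is connected to the 3-Novikov system $$u_t+(upr)_x=0,\quad v_t+3vp_xr+v_xpr+u^2p=0,\quad w_t+3wpr_x+w_xpr-u^2r=0,\quad v=p-p_{xx},\ w=r-r_{xx}$$ via $$u=(m_2m_3)^{1/2},\quad v=m_2,\quad w=m_1-m_{3x},\quad p=u_2,\quad r=g,$$ i.e. these substitutions turn a solution of the first system into a solution of the 3-Novikov system.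
   Context: All functions are smooth functions of $(x,t)$ with $m_2m_3>0$, so that the square root is smooth. *)

theory Defs
  imports "HOL-Analysis.Analysis"
begin

text \<open>Functions of \<open>(x, t)\<close> are functions on \<^typ>\<open>real \<times> real\<close>, with \<open>x\<close> the first component.\<close>

definition dx :: "(real \<times> real \<Rightarrow> real) \<Rightarrow> real \<times> real \<Rightarrow> real" where
  "dx F = (\<lambda>(x, t). deriv (\<lambda>s. F (s, t)) x)"

definition dt :: "(real \<times> real \<Rightarrow> real) \<Rightarrow> real \<times> real \<Rightarrow> real" where
  "dt F = (\<lambda>(x, t). deriv (\<lambda>s. F (x, s)) t)"

primrec Ck_on :: "nat \<Rightarrow> (real \<times> real) set \<Rightarrow> (real \<times> real \<Rightarrow> real) \<Rightarrow> bool" where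
  "Ck_on 0 D F \<longleftrightarrow> continuous_on D F"
| "Ck_on (Suc k) D F \<longleftrightarrow> F differentiable_on D \<and> Ck_on k D (dx F) \<and> Ck_on k D (dt F)"

text \<open>Intended for open \<open>D\<close>, where \<^const>\<open>dx\<close> and \<^const>\<open>dt\<close> only depend on the values on \<open>D\<close>.\<close>

definition smooth_on :: "(real \<times> real) set \<Rightarrow> (real \<times> real \<Rightarrow> real) \<Rightarrow> bool" where
  "smooth_on D F \<longleftrightarrow> (\<forall>k. Ck_on k D F)"

definition momentum :: "(real \<times> real \<Rightarrow> real) \<Rightarrow> real \<times> real \<Rightarrow> real" where
  "momentum F = (\<lambda>z. F z - dx (dx F) z)"

definition CH3_f :: "(real \<times> real \<Rightarrow> real) \<Rightarrow> (real \<times> real \<Rightarrow> real) \<Rightarrow> real \<times> real \<Rightarrow> real" where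
  "CH3_f u\<^sub>1 u\<^sub>3 = (\<lambda>z. u\<^sub>3 z - dx u\<^sub>1 z)"

definition CH3_g :: "(real \<times> real \<Rightarrow> real) \<Rightarrow> (real \<times> real \<Rightarrow> real) \<Rightarrow> real \<times> real \<Rightarrow> real" where
  "CH3_g u\<^sub>1 u\<^sub>3 = (\<lambda>z. u\<^sub>1 z - dx u\<^sub>3 z)"

definition CH3_solution ::
  "(real \<times> real) set \<Rightarrow> (real \<times> real \<Rightarrow> real) \<Rightarrow> (real \<times> real \<Rightarrow> real) \<Rightarrow> (real \<times> real \<Rightarrow> real) \<Rightarrow> bool"
where
  "CH3_solution D u\<^sub>1 u\<^sub>2 u\<^sub>3 \<longleftrightarrow>
    (let m\<^sub>1 = momentum u\<^sub>1; m\<^sub>2 = momentum u\<^sub>2; m\<^sub>3 = momentum u\<^sub>3;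
         f = CH3_f u\<^sub>1 u\<^sub>3; g = CH3_g u\<^sub>1 u\<^sub>3
     in smooth_on D u\<^sub>1 \<and> smooth_on D u\<^sub>2 \<and> smooth_on D u\<^sub>3 \<and>
        (\<forall>z\<in>D.
          dt m\<^sub>1 z + u\<^sub>2 z * g z * dx m\<^sub>1 z - m\<^sub>3 z * (dx u\<^sub>2 z * f z - u\<^sub>2 z * g z)
            - m\<^sub>1 z * (3 * u\<^sub>2 z * f z - m\<^sub>3 z * u\<^sub>2 z) = 0 \<and>
          dt m\<^sub>2 z + u\<^sub>2 z * g z * dx m\<^sub>2 z + m\<^sub>2 z * (3 * dx u\<^sub>2 z * g z + m\<^sub>3 z * u\<^sub>2 z) = 0 \<and>
          dt m\<^sub>3 z + u\<^sub>2 z * g z * dx m\<^sub>3 z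
            - m\<^sub>3 z * (2 * u\<^sub>2 z * f z + dx u\<^sub>2 z * g z - m\<^sub>3 z * u\<^sub>2 z) = 0))"

definition Novikov3_solution ::
  "(real \<times> real) set \<Rightarrow> (real \<times> real \<Rightarrow> real) \<Rightarrow> (real \<times> real \<Rightarrow> real) \<Rightarrow> (real \<times> real \<Rightarrow> real)
    \<Rightarrow> (real \<times> real \<Rightarrow> real) \<Rightarrow> (real \<times> real \<Rightarrow> real) \<Rightarrow> bool"
where
  "Novikov3_solution D u v w p r \<longleftrightarrow>
     smooth_on D u \<and> smooth_on D v \<and> smooth_on D w \<and> smooth_on D p \<and> smooth_on D r \<and>
     (\<forall>z\<in>D.
       dt u z + dx (\<lambda>y. u y * p y * r y) z = 0 \<and>
       dt v z + 3 * v z * dx p z * r z + dx v z * p z * r z + (u z)\<^sup>2 * p z = 0 \<and>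
       dt w z + 3 * w z * p z * dx r z + dx w z * p z * r z - (u z)\<^sup>2 * r z = 0 \<and>
       v z = p z - dx (dx p) z \<and>
       w z = r z - dx (dx r) z)"

end

theory Submission
  imports Defs
begin

text \<open>
  Since \<open>f + g\<^sub>x = m\<^sub>3\<close>, one can eliminate \<open>f\<close>. The equations for \<open>m\<^sub>2\<close> and \<open>m\<^sub>3\<close> then combine to the
  conservation law for \<open>m\<^sub>2 m\<^sub>3\<close>, and subtracting the \<open>x\<close>-derivative of the \<open>m\<^sub>3\<close>-equation from
  the \<open>m\<^sub>1\<close>-equation leaves the equation for \<open>w\<close> up to the multiple \<open>2 p m\<^sub>3 (w - (r - r\<^sub>x\<^sub>x))\<close> of
  the identity \<open>w = r - r\<^sub>x\<^sub>x\<close>; symmetry of the mixed partial derivatives of \<open>m\<^sub>3\<close>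
  rewrites the \<open>m\<^sub>3\<^sub>x\<^sub>t\<close> occurring in \<open>w\<^sub>t\<close> as the \<open>m\<^sub>3\<^sub>t\<^sub>x\<close> that the differentiated equation gives.
\<close>

section \<open>Partial derivatives of totally differentiable functions and their calculus
  rules\<close>

lemma partials_of_has_derivative:
  assumes "(F has_derivative F') (at z)"
  shows "dx F z = F' (1, 0)" and "dt F z = F' (0, 1)"
proof -
  obtain x t where z: "z = (x, t)" by fastforce
  have lin: "linear F'"
    using assms has_derivative_linear by blast
  have "((\<lambda>s. F (s, t)) has_derivative (\<lambda>h. F' (h, 0))) (at x)"
    by (rule has_derivative_compose[where g = F and f = "\<lambda>s. (s, t)", OF _ assms[unfolded z]])
       (auto intro!: derivative_eq_intros)
  then have "((\<lambda>s. F (s, t)) has_real_derivative F' (1, 0)) (at x)"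
    by (rule has_derivative_imp_has_field_derivative)
       (use linear_scale[OF lin, of _ "(1, 0)", symmetric] in simp)
  then show "dx F z = F' (1, 0)"
    by (simp add: dx_def z DERIV_imp_deriv)
  have "((\<lambda>s. F (x, s)) has_derivative (\<lambda>h. F' (0, h))) (at t)"
    by (rule has_derivative_compose[where g = F and f = "\<lambda>s. (x, s)", OF _ assms[unfolded z]])
       (auto intro!: derivative_eq_intros)
  then have "((\<lambda>s. F (x, s)) has_real_derivative F' (0, 1)) (at t)"
    by (rule has_derivative_imp_has_field_derivative)
       (use linear_scale[OF lin, of _ "(0, 1)", symmetric] in simp)
  then show "dt F z = F' (0, 1)"
    by (simp add: dt_def z DERIV_imp_deriv)
qed

text \<open>\<open>deriv\<close> takes an arbitrary value where no derivative exists; total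
  differentiability makes \<open>dx F\<close> and \<open>dt F\<close> genuine derivatives along the
  coordinate lines, as the mean value theorem requires.\<close>

lemma differentiable_imp_partials:
  assumes "F differentiable at (x, t)"
  shows "((\<lambda>s. F (s, t)) has_real_derivative dx F (x, t)) (at x)"
    and "((\<lambda>s. F (x, s)) has_real_derivative dt F (x, t)) (at t)"
proof -
  have "(\<lambda>s. F (s, t)) differentiable at x"
    by (rule differentiable_compose[where f = F and g = "\<lambda>s. (s, t)"])
       (use assms in auto)
  then show "((\<lambda>s. F (s, t)) has_real_derivative dx F (x, t)) (at x)"
    by (simp add: dx_def DERIV_deriv_iff_real_differentiable)
  have "(\<lambda>s. F (x, s)) differentiable at t"
    by (rule differentiable_compose[where f = F and g = "\<lambda>s. (x, s)"])
       (use assms in auto)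
  then show "((\<lambda>s. F (x, s)) has_real_derivative dt F (x, t)) (at t)"
    by (simp add: dt_def DERIV_deriv_iff_real_differentiable)
qed

text \<open>Derivatives are local, so identities valid only on the open set \<open>D\<close> may be
  differentiated there.\<close>

lemma partials_cong:
  assumes "open D" "z \<in> D" "F differentiable at z" "\<And>y. y \<in> D \<Longrightarrow> F y = G y"
  shows "dx G z = dx F z" and "dt G z = dt F z"
proof -
  obtain F' where F: "(F has_derivative F') (at z)"
    using assms(3) by (auto simp: differentiable_def)
  then have "(G has_derivative F') (at z)"
    by (rule has_derivative_transform_within_open) (fact assms)+
  note F[THEN partials_of_has_derivative(1)] F[THEN partials_of_has_derivative(2)]
    this[THEN partials_of_has_derivative(1)] this[THEN partials_of_has_derivative(2)]
  then show "dx G z = dx F z" "dt G z = dt F z"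
    by simp_all
qed

lemma partials_add_scaled:
  assumes "F differentiable at z" "G differentiable at z"
  shows "dx (\<lambda>y. F y + c * G y) z = dx F z + c * dx G z"
    and "dt (\<lambda>y. F y + c * G y) z = dt F z + c * dt G z"
proof -
  obtain F' G' where FG: "(F has_derivative F') (at z)" "(G has_derivative G') (at z)"
    using assms by (auto simp: differentiable_def)
  then have "((\<lambda>y. F y + c * G y) has_derivative (\<lambda>h. F' h + c * G' h)) (at z)"
    by (auto intro!: derivative_eq_intros)
  with FG show "dx (\<lambda>y. F y + c * G y) z = dx F z + c * dx G z"
    and "dt (\<lambda>y. F y + c * G y) z = dt F z + c * dt G z"
    by (simp_all add: partials_of_has_derivative)
qed

lemma partials_mult:
  assumes "F differentiable at z" "G differentiable at z"
  shows "dx (\<lambda>y. F y * G y) z = F z * dx G z + dx F z * G z"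
    and "dt (\<lambda>y. F y * G y) z = F z * dt G z + dt F z * G z"
proof -
  obtain F' G' where FG: "(F has_derivative F') (at z)" "(G has_derivative G') (at z)"
    using assms by (auto simp: differentiable_def)
  note this[THEN partials_of_has_derivative(1)] this[THEN partials_of_has_derivative(2)]
    has_derivative_mult[OF this, THEN partials_of_has_derivative(1)]
    has_derivative_mult[OF this, THEN partials_of_has_derivative(2)]
  then show "dx (\<lambda>y. F y * G y) z = F z * dx G z + dx F z * G z"
    and "dt (\<lambda>y. F y * G y) z = F z * dt G z + dt F z * G z"
    by (simp_all add: partials_of_has_derivative)
qed

text \<open>Writing the derivative with exponent \<open>a - 1\<close>, not as a quotient by
  \<open>F z\<close>, keeps it in the form of a power times a partial of \<open>F\<close>, which
  suits induction on the order of differentiability.\<close>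

lemma partials_powr:
  assumes "F differentiable at z" "F z > 0"
  shows "(\<lambda>y. F y powr a) differentiable at z"
    and "dx (\<lambda>y. F y powr a) z = a * (F z powr (a - 1) * dx F z)"
    and "dt (\<lambda>y. F y powr a) z = a * (F z powr (a - 1) * dt F z)"
proof -
  obtain F' where F: "(F has_derivative F') (at z)"
    using assms by (auto simp: differentiable_def)
  have D: "((\<lambda>y. F y powr a) has_derivative (\<lambda>h. a * (F z powr (a - 1) * F' h))) (at z)"
    by (rule has_derivative_eq_rhs[OF has_derivative_powr[OF F has_derivative_const]])
       (use assms in \<open>auto simp: powr_diff fun_eq_iff\<close>)
  from D show "(\<lambda>y. F y powr a) differentiable at z"
    by (auto simp: differentiable_def)
  from D F show "dx (\<lambda>y. F y powr a) z = a * (F z powr (a - 1) * dx F z)"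
    and "dt (\<lambda>y. F y powr a) z = a * (F z powr (a - 1) * dt F z)"
    by (simp_all add: partials_of_has_derivative)
qed

section \<open>Closure of \<open>Ck_on\<close> and \<open>smooth_on\<close> under algebraic
  operations, powers and square roots\<close>

lemma Ck_on_cong:
  assumes "open D"
  shows "Ck_on k D F \<Longrightarrow> (\<And>y. y \<in> D \<Longrightarrow> F y = G y) \<Longrightarrow> Ck_on k D G"
proof (induction k arbitrary: F G)
  case 0
  then show ?case by (simp cong: continuous_on_cong)
next
  case (Suc k)
  have dF: "F differentiable at z" if "z \<in> D" for z
    using Suc.prems(1) that assms by (simp add: differentiable_on_eq_differentiable_at)
  have "G differentiable at z" if "z \<in> D" for z
    using dF[OF that] has_derivative_transform_within_open[where f = F and g = G, OF _ assms that Suc.prems(2)]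
    unfolding differentiable_def by blast
  \<comment> \<open>The partials of \<open>F\<close> and \<open>G\<close> also agree on
    \<open>D\<close>, so the induction hypothesis applies to them.\<close>
  moreover have "Ck_on k D (dx G)" "Ck_on k D (dt G)"
    using Suc.prems(1) partials_cong[OF assms _ dF Suc.prems(2)]
    by (auto intro: Suc.IH[of "dx F"] Suc.IH[of "dt F"])
  ultimately show ?case
    using assms by (simp add: differentiable_on_eq_differentiable_at)
qed

lemma Ck_on_SucD: "Ck_on (Suc k) D F \<Longrightarrow> Ck_on k D F"
proof (induction k arbitrary: F)
  case 0
  then show ?case by (simp add: differentiable_imp_continuous_on)
next
  case (Suc k)
  have "F differentiable_on D" and dF: "Ck_on (Suc k) D (dx F)" "Ck_on (Suc k) D (dt F)"
    using iffD1[OF Ck_on.simps(2) Suc.prems] by blast+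
  with dF[THEN Suc.IH] show ?case by (simp only: Ck_on.simps(2) simp_thms)
qed

text \<open>A single induction covers sums (\<open>c = 1\<close>), differences
  (\<open>c = -1\<close>) and, with \<open>G = F\<close>, scalar multiples.\<close>

lemma Ck_on_add_scaled:
  assumes "open D"
  shows "Ck_on k D F \<Longrightarrow> Ck_on k D G \<Longrightarrow> Ck_on k D (\<lambda>z. F z + c * G z)"
proof (induction k arbitrary: F G)
  case 0
  then show ?case by (auto intro!: continuous_intros)
next
  case (Suc k)
  have d: "F differentiable at z" "G differentiable at z" if "z \<in> D" for z
    using Suc.prems that assms by (simp_all add: differentiable_on_eq_differentiable_at)
  have "Ck_on k D (\<lambda>z. dx F z + c * dx G z)" "Ck_on k D (\<lambda>z. dt F z + c * dt G z)"
    using Suc.prems by (simp_all only: Ck_on.simps Suc.IH)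
  note this[THEN Ck_on_cong[OF assms]]
  then have "Ck_on k D (dx (\<lambda>z. F z + c * G z))" "Ck_on k D (dt (\<lambda>z. F z + c * G z))"
    by (simp_all add: partials_add_scaled d)
  then show ?case
    using d assms by (auto simp: differentiable_on_eq_differentiable_at)
qed

lemma Ck_on_mult:
  assumes "open D"
  shows "Ck_on k D F \<Longrightarrow> Ck_on k D G \<Longrightarrow> Ck_on k D (\<lambda>z. F z * G z)"
proof (induction k arbitrary: F G)
  case 0
  then show ?case by (auto intro!: continuous_intros)
next
  case (Suc k)
  have d: "F differentiable at z" "G differentiable at z" if "z \<in> D" for z
    using Suc.prems that assms by (simp_all add: differentiable_on_eq_differentiable_at)
  \<comment> \<open>The product rule leaves undifferentiated factors, which are needed at order
    \<open>k\<close>. The factor 1 below gives the sum the shape of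
    \<open>Ck_on_add_scaled\<close>.\<close>
  note FG = Suc.prems[THEN Ck_on_SucD]
  have "Ck_on k D (\<lambda>z. F z * dx G z + 1 * (dx F z * G z))"
    "Ck_on k D (\<lambda>z. F z * dt G z + 1 * (dt F z * G z))"
    using Suc.prems FG by (simp_all only: Ck_on.simps Ck_on_add_scaled[OF assms] Suc.IH)
  note this[THEN Ck_on_cong[OF assms]]
  then have "Ck_on k D (dx (\<lambda>z. F z * G z))" "Ck_on k D (dt (\<lambda>z. F z * G z))"
    by (simp_all add: partials_mult d)
  then show ?case
    using d assms by (auto simp: differentiable_on_eq_differentiable_at)
qed

lemma Ck_on_scale:
  assumes "open D" "Ck_on k D F"
  shows "Ck_on k D (\<lambda>z. c * F z)"
  by (rule Ck_on_cong[OF assms(1) Ck_on_add_scaled[OF assms(1,2,2), of "c - 1"]])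
     (simp add: algebra_simps)

text \<open>The exponent must be arbitrary: each differentiation lowers it by one, so an induction
  for the square root alone would not close.\<close>

lemma Ck_on_powr:
  assumes "open D" "\<And>z. z \<in> D \<Longrightarrow> F z > 0"
  shows "Ck_on k D F \<Longrightarrow> Ck_on k D (\<lambda>z. F z powr a)"
proof (induction k arbitrary: a)
  case 0
  then show ?case using assms(2) by (force intro!: continuous_intros)
next
  case (Suc k)
  have d: "F differentiable at z" if "z \<in> D" for z
    using Suc.prems that assms by (simp add: differentiable_on_eq_differentiable_at)
  have "Ck_on k D (\<lambda>z. a * (F z powr (a - 1) * dx F z))"
    "Ck_on k D (\<lambda>z. a * (F z powr (a - 1) * dt F z))"
    using Suc.prems Suc.IH[OF Ck_on_SucD[OF Suc.prems], of "a - 1"]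
    by (simp_all only: Ck_on.simps Ck_on_scale Ck_on_mult assms(1))
  note this[THEN Ck_on_cong[OF assms(1)]]
  then have "Ck_on k D (dx (\<lambda>z. F z powr a))" "Ck_on k D (dt (\<lambda>z. F z powr a))"
    by (simp_all add: partials_powr d assms(2))
  then show ?case
    using d assms by (auto simp: differentiable_on_eq_differentiable_at partials_powr)
qed

lemma smooth_on_differentiable:
  assumes "open D" "smooth_on D F" "z \<in> D"
  shows "F differentiable at z"
proof -
  have "Ck_on (Suc 0) D F"
    using assms(2) unfolding smooth_on_def by blast
  then show ?thesis
    using assms by (simp add: differentiable_on_eq_differentiable_at)
qed

lemma smooth_on_continuous_on: "smooth_on D F \<Longrightarrow> continuous_on D F"
  unfolding smooth_on_def by (metis Ck_on.simps(1))

lemma smooth_on_partials: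
  assumes "smooth_on D F"
  shows "smooth_on D (dx F)" "smooth_on D (dt F)"
proof -
  have "Ck_on (Suc k) D F" for k
    using assms unfolding smooth_on_def by blast
  then show "smooth_on D (dx F)" "smooth_on D (dt F)"
    unfolding smooth_on_def by auto
qed

lemma smooth_on_diff:
  assumes "open D" "smooth_on D F" "smooth_on D G"
  shows "smooth_on D (\<lambda>z. F z - G z)"
  using assms Ck_on_add_scaled[OF assms(1), of _ F G "-1"] by (simp add: smooth_on_def)

lemma smooth_on_mult:
  assumes "open D" "smooth_on D F" "smooth_on D G"
  shows "smooth_on D (\<lambda>z. F z * G z)"
  using assms Ck_on_mult unfolding smooth_on_def by blast

lemma smooth_on_sqrt:
  assumes "open D" "smooth_on D F" "\<And>z. z \<in> D \<Longrightarrow> F z > 0"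
  shows "smooth_on D (\<lambda>z. sqrt (F z))"
  unfolding smooth_on_def
proof
  fix k
  have "Ck_on k D (\<lambda>z. F z powr (1 / 2))"
    using assms Ck_on_powr unfolding smooth_on_def by blast
  then show "Ck_on k D (\<lambda>z. sqrt (F z))"
    by (rule Ck_on_cong[OF assms(1)]) (use assms(3) in \<open>auto simp: powr_half_sqrt less_imp_le\<close>)
qed

lemma partials_diff:
  assumes "F differentiable at z" "G differentiable at z"
  shows "dx (\<lambda>y. F y - G y) z = dx F z - dx G z"
    and "dt (\<lambda>y. F y - G y) z = dt F z - dt G z"
  using partials_add_scaled[OF assms, of "-1"] by simp_all

section \<open>Symmetry of the mixed partial derivatives\<close>

lemma second_difference_mean_value:
  fixes F :: "real \<times> real \<Rightarrow> real"
  assumes "h > 0"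
    and Fx: "\<And>s y. s \<in> {x..x+h} \<Longrightarrow> y \<in> {t..t+h} \<Longrightarrow>
      ((\<lambda>s. F (s, y)) has_real_derivative Fx s y) (at s)"
    and Fxt: "\<And>s y. s \<in> {x..x+h} \<Longrightarrow> y \<in> {t..t+h} \<Longrightarrow>
      ((\<lambda>y. Fx s y) has_real_derivative Fxt s y) (at y)"
  obtains s y where "s \<in> {x..x+h}" "y \<in> {t..t+h}"
    "F (x+h, t+h) - F (x+h, t) - F (x, t+h) + F (x, t) = h\<^sup>2 * Fxt s y"
proof -
  \<comment> \<open>The mean value theorem is applied in the first variable to the increment in the
    second, and then in the second variable to \<open>Fx s\<close>; each application yields one
    factor \<open>h\<close>.\<close>
  have "\<exists>s>x. s < x + h \<and> (F (x+h, t+h) - F (x+h, t)) - (F (x, t+h) - F (x, t))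
      = (x + h - x) * (Fx s (t+h) - Fx s t)"
    by (rule MVT2[where f = "\<lambda>s. F (s, t+h) - F (s, t)"])
       (use assms(1) in \<open>auto intro!: derivative_eq_intros Fx\<close>)
  then obtain s where s: "x < s" "s < x + h"
    "(F (x+h, t+h) - F (x+h, t)) - (F (x, t+h) - F (x, t)) = h * (Fx s (t+h) - Fx s t)"
    by auto
  have "\<exists>y>t. y < t + h \<and> Fx s (t+h) - Fx s t = (t + h - t) * Fxt s y"
    by (rule MVT2) (use assms(1) s in \<open>auto intro!: Fxt\<close>)
  then obtain y where "t < y" "y < t + h" "Fx s (t+h) - Fx s t = h * Fxt s y"
    by auto
  with s show thesis
    by (intro that[of s y]) (auto simp: power2_eq_square)
qed

text \<open>If the two mixed partials differed at \<open>z\<close>, continuity would keep their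
  values apart near \<open>z\<close>. Yet the second difference of \<open>F\<close> over a small
  square is the square of the side times a value of either one, so they share a value there.\<close>

lemma mixed_partials_commute:
  assumes "open D" "smooth_on D F" "z \<in> D"
  shows "dx (dt F) z = dt (dx F) z"
proof (rule ccontr)
  define A B where "A = dx (dt F)" and "B = dt (dx F)"
  assume "\<not> ?thesis"
  then have pos: "\<bar>A z - B z\<bar> / 2 > 0" by (simp add: A_def B_def)
  have cont: "continuous_on D A" "continuous_on D B"
    using assms(2) by (auto simp: A_def B_def intro: smooth_on_continuous_on smooth_on_partials)
  obtain x t where z: "z = (x, t)" by fastforce
  have "continuous (at z) A" "continuous (at z) B"
    using cont assms(1,3) continuous_on_eq_continuous_at by blast+
  then have "\<forall>\<^sub>F y in nhds z. dist (A y) (A z) < \<bar>A z - B z\<bar> / 2"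
    "\<forall>\<^sub>F y in nhds z. dist (B y) (B z) < \<bar>A z - B z\<bar> / 2"
    using pos by (simp_all only: continuous_at tendsto_at_iff_tendsto_nhds tendstoD)
  moreover have "\<forall>\<^sub>F y in nhds z. y \<in> D"
    using assms(1,3) by (rule eventually_nhds_in_open)
  ultimately have "\<forall>\<^sub>F y in nhds z. y \<in> D \<and> dist (A y) (A z) < \<bar>A z - B z\<bar> / 2
      \<and> dist (B y) (B z) < \<bar>A z - B z\<bar> / 2"
    by eventually_elim simp
  then obtain e where "e > 0" and e: "\<And>y. dist y z < e \<Longrightarrow> y \<in> D \<and>
      dist (A y) (A z) < \<bar>A z - B z\<bar> / 2 \<and> dist (B y) (B z) < \<bar>A z - B z\<bar> / 2"
    unfolding eventually_nhds_metric by auto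
  \<comment> \<open>A point of the square is at distance at most \<open>2 * h < e\<close> from its
    corner \<open>z\<close>.\<close>
  define h where "h = e / 3"
  have "h > 0" using \<open>e > 0\<close> by (simp add: h_def)
  have near: "dist (s, y) z < e" if "s \<in> {x..x+h}" "y \<in> {t..t+h}" for s y
  proof -
    have "dist (s, y) z \<le> \<bar>s - x\<bar> + \<bar>y - t\<bar>"
      unfolding z dist_Pair_Pair dist_real_def
      using sqrt_sum_squares_le_sum_abs by simp
    also have "\<dots> < e" using that \<open>e > 0\<close> by (auto simp: h_def)
    finally show ?thesis .
  qed
  have inD: "(s, y) \<in> D" if "s \<in> {x..x+h}" "y \<in> {t..t+h}" for s y
    using e near that by blast
  note diff = differentiable_imp_partials[OF smooth_on_differentiable[OF assms(1) _ inD]]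
  note diffs = diff[OF assms(2)]
    diff(2)[OF smooth_on_partials(1)[OF assms(2)]] diff(1)[OF smooth_on_partials(2)[OF assms(2)]]
  obtain s y where sy: "s \<in> {x..x+h}" "y \<in> {t..t+h}"
    and 1: "F (x+h, t+h) - F (x+h, t) - F (x, t+h) + F (x, t) = h\<^sup>2 * B (s, y)"
    by (rule second_difference_mean_value[OF \<open>h > 0\<close>, of x t F "\<lambda>s y. dx F (s, y)" "\<lambda>s y. B (s, y)"])
       (auto simp: B_def intro!: diffs)
  \<comment> \<open>The same second difference with the coordinates of \<open>F\<close> swapped, so
    that differentiation in \<open>t\<close> comes first.\<close>
  obtain y' s' where sy': "y' \<in> {t..t+h}" "s' \<in> {x..x+h}"
    and 2: "F (x+h, t+h) - F (x, t+h) - F (x+h, t) + F (x, t) = h\<^sup>2 * A (s', y')"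
    by (rule second_difference_mean_value[OF \<open>h > 0\<close>, of t x "\<lambda>(y, s). F (s, y)"
          "\<lambda>y s. dt F (s, y)" "\<lambda>y s. A (s, y)"])
       (auto simp: A_def intro!: diffs)
  have "h\<^sup>2 * B (s, y) = h\<^sup>2 * A (s', y')"
    using 1 2 by linarith
  then have "B (s, y) = A (s', y')"
    using \<open>h > 0\<close> by simp
  moreover have "dist (B (s, y)) (B z) < \<bar>A z - B z\<bar> / 2" "dist (A (s', y')) (A z) < \<bar>A z - B z\<bar> / 2"
    using e near sy sy' by blast+
  ultimately show False
    \<comment> \<open>A common value would lie within half the gap of both \<open>A z\<close> and
      \<open>B z\<close>, strictly, which is impossible.\<close>
    by (auto simp: dist_real_def abs_if split: if_splits)
qed

section \<open>Passage from the Camassa-Holm type system to the 3-Novikov system\<close>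

lemma partials_sqrt_sq:
  assumes "(\<lambda>y. sqrt (F y)) differentiable at z" "open D" "z \<in> D" "\<And>y. y \<in> D \<Longrightarrow> F y > 0"
  shows "dx F z = 2 * (sqrt (F z) * dx (\<lambda>y. sqrt (F y)) z)"
    and "dt F z = 2 * (sqrt (F z) * dt (\<lambda>y. sqrt (F y)) z)"
proof -
  \<comment> \<open>Differentiating this identity on \<open>D\<close> avoids quotients by the root,
    so the later algebra stays polynomial.\<close>
  have "sqrt (F y) * sqrt (F y) = F y" if "y \<in> D" for y
    using assms(4)[OF that] by (simp add: real_sqrt_mult_self)
  note eq = partials_cong[where F = "\<lambda>y. sqrt (F y) * sqrt (F y)",
      OF assms(2,3) differentiable_mult[OF assms(1,1)] this]
  show "dx F z = 2 * (sqrt (F z) * dx (\<lambda>y. sqrt (F y)) z)"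
    by (rule trans[OF eq(1)]) (simp_all only: partials_mult[OF assms(1,1)] mult_2 mult.commute)
  show "dt F z = 2 * (sqrt (F z) * dt (\<lambda>y. sqrt (F y)) z)"
    by (rule trans[OF eq(2)]) (simp_all only: partials_mult[OF assms(1,1)] mult_2 mult.commute)
qed

theorem mainTheorem7:
  fixes D :: "(real \<times> real) set" and u\<^sub>1 u\<^sub>2 u\<^sub>3 :: "real \<times> real \<Rightarrow> real"
  defines "m\<^sub>1 \<equiv> momentum u\<^sub>1" and "m\<^sub>2 \<equiv> momentum u\<^sub>2" and "m\<^sub>3 \<equiv> momentum u\<^sub>3"
    and "g \<equiv> CH3_g u\<^sub>1 u\<^sub>3"
  assumes "open D"
    and "CH3_solution D u\<^sub>1 u\<^sub>2 u\<^sub>3"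
    and "\<And>z. z \<in> D \<Longrightarrow> m\<^sub>2 z * m\<^sub>3 z > 0"
  shows "Novikov3_solution D (\<lambda>z. sqrt (m\<^sub>2 z * m\<^sub>3 z)) m\<^sub>2 (\<lambda>z. m\<^sub>1 z - dx m\<^sub>3 z) u\<^sub>2 g"
proof -
  note D = \<open>open D\<close> and pos = assms(7)
  define f where "f = CH3_f u\<^sub>1 u\<^sub>3"
  define u where "u = (\<lambda>z. sqrt (m\<^sub>2 z * m\<^sub>3 z))"
  have su: "smooth_on D u\<^sub>1" "smooth_on D u\<^sub>2" "smooth_on D u\<^sub>3"
    and E1: "\<And>z. z \<in> D \<Longrightarrow> dt m\<^sub>1 z + u\<^sub>2 z * g z * dx m\<^sub>1 z
      - m\<^sub>3 z * (dx u\<^sub>2 z * f z - u\<^sub>2 z * g z) - m\<^sub>1 z * (3 * u\<^sub>2 z * f z - m\<^sub>3 z * u\<^sub>2 z) = 0"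
    and E2: "\<And>z. z \<in> D \<Longrightarrow> dt m\<^sub>2 z + u\<^sub>2 z * g z * dx m\<^sub>2 z
      + m\<^sub>2 z * (3 * dx u\<^sub>2 z * g z + m\<^sub>3 z * u\<^sub>2 z) = 0"
    and E3: "\<And>z. z \<in> D \<Longrightarrow> dt m\<^sub>3 z + u\<^sub>2 z * g z * dx m\<^sub>3 z
      - m\<^sub>3 z * (2 * u\<^sub>2 z * f z + dx u\<^sub>2 z * g z - m\<^sub>3 z * u\<^sub>2 z) = 0"
    using assms(6) unfolding CH3_solution_def Let_def m\<^sub>1_def m\<^sub>2_def m\<^sub>3_def f_def g_def by auto
  note smooths = smooth_on_partials smooth_on_diff[OF D] smooth_on_mult[OF D]
  note dble = smooth_on_differentiable[OF D]
  have sm: "smooth_on D m\<^sub>1" "smooth_on D m\<^sub>2" "smooth_on D m\<^sub>3"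
    unfolding m\<^sub>1_def m\<^sub>2_def m\<^sub>3_def momentum_def by (intro smooths su)+
  have sg: "smooth_on D g"
    unfolding g_def CH3_g_def by (intro smooths su)
  have squ: "smooth_on D u"
    unfolding u_def by (intro smooth_on_sqrt[OF D] smooths sm pos)
  have u2: "(u z)\<^sup>2 = m\<^sub>2 z * m\<^sub>3 z" "u z > 0" if "z \<in> D" for z
    using pos[OF that] by (simp_all add: u_def)
  have dg: "dx g z = dx u\<^sub>1 z - dx (dx u\<^sub>3) z" if "z \<in> D" for z
    unfolding g_def CH3_g_def
    by (intro partials_diff dble[OF _ that] smooths su)
  have ddg: "dx (dx g) z = dx (dx u\<^sub>1) z - dx (dx (dx u\<^sub>3)) z" if "z \<in> D" for z
  proof -
    have "dx (dx g) z = dx (\<lambda>y. dx u\<^sub>1 y - dx (dx u\<^sub>3) y) z"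
      by (rule partials_cong[OF D that]) (use that dg in \<open>auto intro!: dble smooths su\<close>)
    also have "\<dots> = dx (dx u\<^sub>1) z - dx (dx (dx u\<^sub>3)) z"
      by (intro partials_diff dble[OF _ that] smooths su)
    finally show ?thesis .
  qed
  \<comment> \<open>The terms \<open>dx u\<^sub>1\<close> in \<open>f\<close> and in
    \<open>dx g\<close> cancel, leaving the momentum of \<open>u\<^sub>3\<close>.\<close>
  have f: "f z = m\<^sub>3 z - dx g z" if "z \<in> D" for z
    using dg[OF that] by (simp add: f_def CH3_f_def m\<^sub>3_def momentum_def)
  \<comment> \<open>Taking momentum commutes with \<open>dx\<close>, so
    \<open>m\<^sub>1 - dx m\<^sub>3\<close> is the momentum of
    \<open>u\<^sub>1 - dx u\<^sub>3\<close>, which is \<open>g\<close>.\<close>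
  have "dx m\<^sub>3 z = dx u\<^sub>3 z - dx (dx (dx u\<^sub>3)) z" if "z \<in> D" for z
    unfolding m\<^sub>3_def momentum_def
    by (intro partials_diff dble[OF _ that] smooths su)
  then have w: "m\<^sub>1 z - dx m\<^sub>3 z = g z - dx (dx g) z" if "z \<in> D" for z
    using ddg[OF that] that by (simp add: m\<^sub>1_def momentum_def g_def CH3_g_def)
  \<comment> \<open>Built from products and differences only, so that \<open>partials_mult\<close> and
    \<open>partials_diff\<close> suffice to differentiate it.\<close>
  have E3': "m\<^sub>3 z * (m\<^sub>3 z * u\<^sub>2 z - (u\<^sub>2 z * dx g z - (dx u\<^sub>2 z * g z - u\<^sub>2 z * dx g z)))
      - u\<^sub>2 z * g z * dx m\<^sub>3 z = dt m\<^sub>3 z" if "z \<in> D" for z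
    using E3[OF that] by (simp add: f[OF that] algebra_simps)
  have dE3: "dx (dt m\<^sub>3) z =
      dx m\<^sub>3 z * (m\<^sub>3 z * u\<^sub>2 z - 2 * u\<^sub>2 z * dx g z + dx u\<^sub>2 z * g z)
      + m\<^sub>3 z * (dx m\<^sub>3 z * u\<^sub>2 z + m\<^sub>3 z * dx u\<^sub>2 z - dx u\<^sub>2 z * dx g z - 2 * u\<^sub>2 z * dx (dx g) z
          + dx (dx u\<^sub>2) z * g z)
      - (dx u\<^sub>2 z * g z + u\<^sub>2 z * dx g z) * dx m\<^sub>3 z - u\<^sub>2 z * g z * dx (dx m\<^sub>3) z" (is "_ = ?R")
    if "z \<in> D" for z
  proof -
    note d = dble[OF _ that] and s = smooths su sm sg
    have "dx (dt m\<^sub>3) z = dx (\<lambda>z. m\<^sub>3 z * (m\<^sub>3 z * u\<^sub>2 z - (u\<^sub>2 z * dx g z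
        - (dx u\<^sub>2 z * g z - u\<^sub>2 z * dx g z))) - u\<^sub>2 z * g z * dx m\<^sub>3 z) z"
      by (rule partials_cong[OF D that _ E3']) (intro d s)
    also have "\<dots> = ?R"
      by (simp only: partials_diff partials_mult d s) (simp add: algebra_simps)
    finally show ?thesis .
  qed
  have "dt u z + dx (\<lambda>y. u y * u\<^sub>2 y * g y) z = 0" if "z \<in> D" for z
  proof -
    note d = dble[OF _ that] and s = smooths su sm sg squ
    have "dx (\<lambda>z. m\<^sub>2 z * m\<^sub>3 z) z = 2 * (u z * dx u z)"
      "dt (\<lambda>z. m\<^sub>2 z * m\<^sub>3 z) z = 2 * (u z * dt u z)"
      using partials_sqrt_sq[OF _ D that pos, folded u_def] d[OF squ] by (simp_all add: u_def)
    then have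
      ux: "m\<^sub>2 z * dx m\<^sub>3 z + dx m\<^sub>2 z * m\<^sub>3 z = 2 * (u z * dx u z)" and
      ut: "m\<^sub>2 z * dt m\<^sub>3 z + dt m\<^sub>2 z * m\<^sub>3 z = 2 * (u z * dt u z)"
      by (simp_all add: partials_mult d s)
    have up: "dx (\<lambda>y. u y * u\<^sub>2 y * g y) z
        = dx u z * u\<^sub>2 z * g z + u z * (dx u\<^sub>2 z * g z + u\<^sub>2 z * dx g z)"
      by (simp add: partials_mult d s algebra_simps)
    \<comment> \<open>Adding \<open>m\<^sub>3\<close> times \<open>E2\<close> to
      \<open>m\<^sub>2\<close> times \<open>E3\<close>, with \<open>f\<close> eliminated, cancels
      the cubic terms in the momenta. What remains is the equation for the square of
      \<open>u\<close>, which is \<open>2 * u\<close> times the claim.\<close>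
    have "u z * (2 * (dt u z + dx (\<lambda>y. u y * u\<^sub>2 y * g y) z)) = 0"
      using ux ut E2[OF that] E3[OF that] u2(1)[OF that] unfolding up f[OF that] by algebra
    then show ?thesis using u2(2)[OF that] by simp
  qed
  moreover have "dt m\<^sub>2 z + 3 * m\<^sub>2 z * dx u\<^sub>2 z * g z + dx m\<^sub>2 z * u\<^sub>2 z * g z + (u z)\<^sup>2 * u\<^sub>2 z = 0"
    if "z \<in> D" for z
    using E2[OF that] by (simp add: u2(1)[OF that] algebra_simps)
  moreover have "dt (\<lambda>z. m\<^sub>1 z - dx m\<^sub>3 z) z + 3 * (m\<^sub>1 z - dx m\<^sub>3 z) * u\<^sub>2 z * dx g z
      + dx (\<lambda>z. m\<^sub>1 z - dx m\<^sub>3 z) z * u\<^sub>2 z * g z - (u z)\<^sup>2 * g z = 0" if "z \<in> D" for z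
  proof -
    note d = dble[OF _ that] and s = smooths su sm sg
    \<comment> \<open>\<open>dE3\<close> contains the second derivative of \<open>u\<^sub>2\<close>;
      expanding \<open>m\<^sub>2\<close> in the term \<open>(u z)\<^sup>2 * g z\<close> exposes the
      matching term that cancels it.\<close>
    have m2: "m\<^sub>2 z = u\<^sub>2 z - dx (dx u\<^sub>2) z"
      by (simp add: m\<^sub>2_def momentum_def)
    have wx: "dx (\<lambda>z. m\<^sub>1 z - dx m\<^sub>3 z) z = dx m\<^sub>1 z - dx (dx m\<^sub>3) z"
      and wt: "dt (\<lambda>z. m\<^sub>1 z - dx m\<^sub>3 z) z = dt m\<^sub>1 z - dx (dt m\<^sub>3) z"
      by (simp_all add: partials_diff d s mixed_partials_commute[OF D sm(3) that])
    show ?thesis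
      using E1[OF that] dE3[OF that] w[OF that]
      unfolding wx wt f[OF that] u2(1)[OF that] m2 by algebra
  qed
  moreover have "m\<^sub>2 z = u\<^sub>2 z - dx (dx u\<^sub>2) z" for z
    by (simp add: m\<^sub>2_def momentum_def)
  moreover have "smooth_on D (\<lambda>z. m\<^sub>1 z - dx m\<^sub>3 z)"
    by (intro smooths sm)
  ultimately show ?thesis
    unfolding Novikov3_solution_def u_def[symmetric]
    using squ sm sg su w by blast
qed

end
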